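(* For fixed $\tau>0$, $$c_\ell(\tau)=C_{\mathrm{BF}}(\tau)\,r(\tau)^\ell\bigl(1+O_\tau(\ell^{-1})\bigr),\qquad\ell\to\infty.$$ Equivalently, $$s_\ell(\tau)=C_{\mathrm{BF}}(\tau)^2\,r(\tau)^{2\ell}\bigl(1+O_\tau(\ell^{-1})\bigr).$$ The coefficient $C_{\mathrm{BF}}(\tau)=(2\sinh2\tau)^{1/4}e^{-\tau/2}$ equals the Gaussian matrix coefficient $|\langle\Omega,\mu(S_\tau)\Omega\rangle|$ of the metaplectic operator associated with $S_\tau=\mathrm{diag}\bigl(\sqrt{\coth\tau},\sqrt{\tanh\tau}\bigr)\in\mathrm{Sp}(2,\mathbb{R})$.
   Context: For $\ell\in\mathbb{N}_0$ let $\mathrm{Sym}^{2\ell}\mathbb{C}^2$ be the space of homogeneous polynomials of degree $2\ell$ in $(z_0,z_1)$ with the Hermitian inner product for which the monomials are orthogonal and $\|z_0^{2\ell-k}z_1^k\|^2=\binom{2\ell}{k}^{-1}$. For $\tau>0$ put $u_\ell=z_0^{2\ell}$, $w_\ell(\tau)=(z_0^2+z_1^2+2\coth\tau\,z_0z_1)^\ell$, $\widehat v=v/\|v\|$, $c_\ell(\tau)=|\langle\widehat w_\ell(\tau),\widehat u_\ell\rangle|$, $s_\ell(\tau)=c_\ell(\tau)^2$, and $r(\tau)=(1-e^{-2\tau})/2$. $\Omega(x)=\pi^{-1/4}e^{-x^2/2}$ is the normalized Gaussian in $L^2(\mathbb{R})$, and $\mu$ is the metaplectic representation; for $a>0$ and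 $S_a=\mathrm{diag}(a,a^{-1})$ it is given, up to a unimodular phase, by $(\mu(S_a)f)(x)=a^{-1/2}f(x/a)$. *)

theory Defs
  imports
    "HOL-Analysis.Analysis"
    "HOL-Computational_Algebra.Polynomial"
    "HOL-Library.Landau_Symbols"
begin

section \<open>Binary forms\<close>

text \<open>
  \<open>\<complex>[z\<^sub>0, z\<^sub>1]\<close> is rendered as \<open>\<complex>[z\<^sub>0][z\<^sub>1]\<close>: the outer polynomial variable is \<open>z\<^sub>1\<close>, the
  inner one \<open>z\<^sub>0\<close>, so the coefficient of \<open>z\<^sub>0\<^sup>i z\<^sub>1\<^sup>k\<close> in \<open>p\<close> is \<open>coeff (coeff p k) i\<close>.
\<close>

definition z0 :: "complex poly poly" where
  "z0 = [:[:0, 1:]:]"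

definition z1 :: "complex poly poly" where
  "z1 = [:0, 1:]"

definition scalar_poly :: "complex \<Rightarrow> complex poly poly" where
  "scalar_poly a = [:[:a:]:]"

definition Sym :: "nat \<Rightarrow> complex poly poly set" where
  "Sym d = {p. \<forall>i k. coeff (coeff p k) i \<noteq> 0 \<longrightarrow> i + k = d}"

text \<open>
  The Hermitian inner product on \<open>Sym d\<close>, antilinear in the first argument; the lemmas
  \<open>Sym_inner_monomials\<close> and \<open>Sym_inner_basis_expansion\<close> below tie it to the defining property
  (orthogonal monomials with prescribed norms).
\<close>

definition Sym_inner :: "nat \<Rightarrow> complex poly poly \<Rightarrow> complex poly poly \<Rightarrow> complex" where
  "Sym_inner d p q =
     (\<Sum>k\<le>d. cnj (coeff (coeff p k) (d - k)) * coeff (coeff q k) (d - k) / of_nat (d choose k))"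

definition Sym_norm :: "nat \<Rightarrow> complex poly poly \<Rightarrow> real" where
  "Sym_norm d p = sqrt (Re (Sym_inner d p p))"

definition Sym_normalize :: "nat \<Rightarrow> complex poly poly \<Rightarrow> complex poly poly" where
  "Sym_normalize d p = scalar_poly (complex_of_real (1 / Sym_norm d p)) * p"

definition coth :: "real \<Rightarrow> real" where
  "coth \<tau> = cosh \<tau> / sinh \<tau>"

definition u_form :: "nat \<Rightarrow> complex poly poly" where
  "u_form l = z0 ^ (2 * l)"

definition w_form :: "nat \<Rightarrow> real \<Rightarrow> complex poly poly" where
  "w_form l \<tau> = (z0\<^sup>2 + z1\<^sup>2 + scalar_poly (complex_of_real (2 * coth \<tau>)) * z0 * z1) ^ l"

definition c_coeff :: "nat \<Rightarrow> real \<Rightarrow> real" where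
  "c_coeff l \<tau> = cmod (Sym_inner (2 * l) (Sym_normalize (2 * l) (w_form l \<tau>)) (Sym_normalize (2 * l) (u_form l)))"

definition s_coeff :: "nat \<Rightarrow> real \<Rightarrow> real" where
  "s_coeff l \<tau> = (c_coeff l \<tau>)\<^sup>2"

definition r_base :: "real \<Rightarrow> real" where
  "r_base \<tau> = (1 - exp (- 2 * \<tau>)) / 2"

definition C_BF :: "real \<Rightarrow> real" where
  "C_BF \<tau> = (2 * sinh (2 * \<tau>)) powr (1 / 4) * exp (- \<tau> / 2)"

lemma coeff_z1_power: "coeff (z1 ^ k) j = (if j = k then 1 else 0)"
  by (simp add: z1_def flip: monom_altdef[of 1, simplified])

lemma coeff_monomial:
  "coeff (coeff (z0 ^ i * z1 ^ k) k') i' = (if i' = i \<and> k' = k then 1 else 0)"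
proof -
  have "z0 ^ i = [:[:0, 1:] ^ i:]"
    by (induction i) (simp_all add: z0_def one_pCons)
  moreover have "[:0, 1:] ^ i = (monom 1 i :: complex poly)"
    by (simp add: monom_altdef)
  ultimately show ?thesis
    by (simp add: coeff_z1_power)
qed

lemma Sym_inner_monomials:
  assumes "k \<le> d" "k' \<le> d"
  shows "Sym_inner d (z0 ^ (d - k) * z1 ^ k) (z0 ^ (d - k') * z1 ^ k') =
    (if k = k' then 1 / of_nat (d choose k) else 0)"
proof -
  have "Sym_inner d (z0 ^ (d - k) * z1 ^ k) (z0 ^ (d - k') * z1 ^ k') =
    (\<Sum>j\<le>d. if j = k then (if k = k' then 1 / of_nat (d choose k) else 0) else 0)"
    unfolding Sym_inner_def coeff_monomial by (intro sum.cong) auto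
  then show ?thesis using assms by simp
qed

lemma coeff_scalar_poly_mult: "coeff (coeff (scalar_poly a * p) k) i = a * coeff (coeff p k) i"
  by (simp add: scalar_poly_def)

lemma Sym_inner_basis_expansion:
  assumes "p \<in> Sym d"
  shows "p = (\<Sum>k\<le>d. scalar_poly (coeff (coeff p k) (d - k)) * (z0 ^ (d - k) * z1 ^ k))"
proof (intro poly_eqI)
  fix k i
  have "coeff (coeff (\<Sum>k\<le>d. scalar_poly (coeff (coeff p k) (d - k)) * (z0 ^ (d - k) * z1 ^ k)) k) i
     = (\<Sum>j\<le>d. if j = k then (if i = d - k then coeff (coeff p k) (d - k) else 0) else 0)"
    unfolding coeff_sum coeff_scalar_poly_mult coeff_monomial by (intro sum.cong) auto
  also have "\<dots> = coeff (coeff p k) i"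
    using assms by (force simp: Sym_def)
  finally show "coeff (coeff p k) i =
      coeff (coeff (\<Sum>k\<le>d. scalar_poly (coeff (coeff p k) (d - k)) * (z0 ^ (d - k) * z1 ^ k)) k) i" ..
qed

lemma Sym_inner_sesquilinear:
  "Sym_inner d p (q + q') = Sym_inner d p q + Sym_inner d p q'"
  "Sym_inner d p (scalar_poly a * q) = a * Sym_inner d p q"
  "Sym_inner d q p = cnj (Sym_inner d p q)"
  by (simp_all only: Sym_inner_def coeff_scalar_poly_mult coeff_add sum_distrib_left cnj_sum
        complex_cnj_mult complex_cnj_divide complex_cnj_cnj complex_cnj_of_nat
        sum.distrib [symmetric])
    (simp_all add: algebra_simps add_divide_distrib)

lemma Sym_mult:
  assumes "p \<in> Sym d" "q \<in> Sym e"
  shows "p * q \<in> Sym (d + e)"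
proof -
  have "i + k = d + e" if "coeff (coeff (p * q) k) i \<noteq> 0" for i k
  proof -
    from that have "(\<Sum>m\<le>k. \<Sum>j\<le>i. coeff (coeff p m) j * coeff (coeff q (k - m)) (i - j)) \<noteq> 0"
      by (simp add: coeff_mult coeff_sum)
    then obtain m j where "m \<le> k" "j \<le> i" "coeff (coeff p m) j \<noteq> 0" "coeff (coeff q (k - m)) (i - j) \<noteq> 0"
      by (metis (no_types, lifting) sum.neutral atMost_iff mult_eq_0_iff)
    then have "j + m = d" "(i - j) + (k - m) = e"
      using assms by (auto simp: Sym_def)
    with \<open>m \<le> k\<close> \<open>j \<le> i\<close> show ?thesis by simp
  qed
  then show ?thesis by (auto simp: Sym_def)
qed

lemma Sym_power: "p \<in> Sym d \<Longrightarrow> p ^ n \<in> Sym (d * n)"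
proof (induction n)
  case 0
  show ?case by (auto simp: Sym_def one_pCons coeff_pCons split: nat.splits)
next
  case (Suc n)
  then show ?case using Sym_mult[of p d "p ^ n" "d * n"] by simp
qed

lemma u_form_Sym: "u_form l \<in> Sym (2 * l)"
proof -
  have "z0 \<in> Sym 1"
    by (auto simp: Sym_def z0_def coeff_pCons split: nat.splits)
  from Sym_power[OF this, of "2 * l"] show ?thesis by (simp add: u_form_def)
qed

lemma w_form_Sym: "w_form l \<tau> \<in> Sym (2 * l)"
proof -
  have "z0\<^sup>2 + z1\<^sup>2 + scalar_poly (complex_of_real (2 * coth \<tau>)) * z0 * z1 \<in> Sym 2"
    by (auto simp: Sym_def z0_def z1_def scalar_poly_def coeff_pCons power2_eq_square split: nat.splits)
  from Sym_power[OF this, of l] show ?thesis by (simp add: w_form_def)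
qed


section \<open>Metaplectic operators on the Hilbert space of square-integrable functions on the line\<close>

text \<open>
  Elements of \<open>L\<^sup>2(\<real>)\<close> are represented by Borel functions, equality being equality almost
  everywhere; the inner product is antilinear in the first argument.
\<close>

definition L2 :: "(real \<Rightarrow> complex) set" where
  "L2 = {f. f \<in> borel_measurable lborel \<and> integrable lborel (\<lambda>x. (cmod (f x))\<^sup>2)}"

definition L2_inner :: "(real \<Rightarrow> complex) \<Rightarrow> (real \<Rightarrow> complex) \<Rightarrow> complex" where
  "L2_inner f g = (LINT x|lborel. cnj (f x) * g x)"

definition L2_eq :: "(real \<Rightarrow> complex) \<Rightarrow> (real \<Rightarrow> complex) \<Rightarrow> bool" where
  "L2_eq f g \<longleftrightarrow> (AE x in lborel. f x = g x)"

definition L2_unitary :: "((real \<Rightarrow> complex) \<Rightarrow> real \<Rightarrow> complex) \<Rightarrow> bool" where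
  "L2_unitary U \<longleftrightarrow>
     (\<forall>f\<in>L2. U f \<in> L2) \<and>
     (\<forall>f\<in>L2. \<forall>g\<in>L2. L2_eq f g \<longrightarrow> L2_eq (U f) (U g)) \<and>
     (\<forall>f\<in>L2. \<forall>g\<in>L2. L2_eq (U (\<lambda>x. f x + g x)) (\<lambda>x. U f x + U g x)) \<and>
     (\<forall>a. \<forall>f\<in>L2. L2_eq (U (\<lambda>x. a * f x)) (\<lambda>x. a * U f x)) \<and>
     (\<forall>f\<in>L2. \<forall>g\<in>L2. L2_inner (U f) (U g) = L2_inner f g) \<and>
     (\<forall>g\<in>L2. \<exists>f\<in>L2. L2_eq (U f) g)"

definition Sp2R :: "(real ^ 2 ^ 2) set" where
  "Sp2R = {S. let J = vector [vector [0, 1], vector [- 1, 0]] in transpose S ** J ** S = J}"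

text \<open>
  The Heisenberg--Weyl operator of the phase-space point \<open>(q, p)\<close> in the Schroedinger
  representation with \<open>\<hbar> = 1\<close>, that is \<open>exp (i (p X - q P))\<close>.
\<close>

definition weyl :: "real ^ 2 \<Rightarrow> (real \<Rightarrow> complex) \<Rightarrow> real \<Rightarrow> complex" where
  "weyl z f x = cis (z $ 2 * x - z $ 1 * z $ 2 / 2) * f (x - z $ 1)"

text \<open>
  The metaplectic operators of \<open>S\<close>: the unitaries intertwining the Schroedinger representation
  with its twist by \<open>S\<close>.  By Stone--von Neumann this determines the operator up to a unimodular
  phase, which is all that matters for the modulus of a matrix coefficient; the two lifts
  of \<open>S\<close> to the metaplectic group are among these operators.
\<close>

definition metaplectic_operator ::
    "real ^ 2 ^ 2 \<Rightarrow> ((real \<Rightarrow> complex) \<Rightarrow> real \<Rightarrow> complex) \<Rightarrow> bool" where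
  "metaplectic_operator S U \<longleftrightarrow>
     S \<in> Sp2R \<and> L2_unitary U \<and>
     (\<forall>z. \<forall>f\<in>L2. L2_eq (U (weyl z f)) (weyl (S *v z) (U f)))"

definition \<Omega> :: "real \<Rightarrow> complex" where
  "\<Omega> x = complex_of_real (pi powr (- 1 / 4) * exp (- x\<^sup>2 / 2))"

definition diag2 :: "real \<Rightarrow> real \<Rightarrow> real ^ 2 ^ 2" where
  "diag2 a b = vector [vector [a, 0], vector [0, b]]"

definition S_tau :: "real \<Rightarrow> real ^ 2 ^ 2" where
  "S_tau \<tau> = diag2 (sqrt (coth \<tau>)) (sqrt (tanh \<tau>))"

text \<open>
  For \<open>S = diag(a, a\<^sup>-\<^sup>1)\<close> the dilation \<open>f \<mapsto> a\<^sup>-\<^sup>1\<^sup>/\<^sup>2 f(\<cdot>/a)\<close> is a metaplectic operator, which fixes the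
  convention relating \<open>S\<close> to the operator and shows that the notion is inhabited.
\<close>

definition dilation :: "real \<Rightarrow> (real \<Rightarrow> complex) \<Rightarrow> real \<Rightarrow> complex" where
  "dilation a f x = complex_of_real (a powr (- 1 / 2)) * f (x / a)"

lemma L2_dilation:
  assumes "a > 0" "f \<in> L2"
  shows "dilation a f \<in> L2"
proof -
  have [measurable]: "f \<in> borel_measurable borel"
    and i: "integrable lborel (\<lambda>x. (cmod (f x))\<^sup>2)"
    using assms(2) by (auto simp: L2_def)
  have "integrable lborel (\<lambda>x. (cmod (f (0 + (1 / a) * x)))\<^sup>2)"
    using lborel_integrable_real_affine[OF i, of "1 / a" 0] assms(1) by simp
  then have "integrable lborel (\<lambda>x. (a powr (- 1 / 2))\<^sup>2 * (cmod (f (x / a)))\<^sup>2)"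
    by simp
  then show ?thesis
    unfolding L2_def dilation_def by (simp add: norm_mult power_mult_distrib)
qed

lemma diag2_Sp2R: "a > 0 \<Longrightarrow> diag2 a (1 / a) \<in> Sp2R"
  by (simp add: Sp2R_def diag2_def Let_def vec_eq_iff forall_2 matrix_matrix_mult_def
      transpose_def sum_2)

lemma L2_inner_dilation:
  assumes "a > 0"
  shows "L2_inner (dilation a f) (dilation a g) = L2_inner f g"
proof -
  have e: "complex_of_real (a powr (- 1 / 2)) * complex_of_real (a powr (- 1 / 2))
      = complex_of_real (1 / a)"
    using assms by (simp add: powr_minus_divide flip: of_real_mult powr_add)
  have "L2_inner (dilation a f) (dilation a g) =
     (LINT x|lborel. complex_of_real (1 / a) * (cnj (f (x / a)) * g (x / a)))"
    unfolding L2_inner_def dilation_def e[symmetric] by (intro Bochner_Integration.integral_cong) auto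
  also have "\<dots> = complex_of_real (1 / a) * (LINT x|lborel. cnj (f (x / a)) * g (x / a))"
    by (rule integral_mult_right_zero)
  also have "\<dots> = L2_inner f g"
    using lborel_integral_real_affine[of "1 / a" "\<lambda>x. cnj (f x) * g x" 0] assms
    by (simp add: L2_inner_def scaleR_conv_of_real)
  finally show ?thesis .
qed

lemma dilation_inverse: "a > 0 \<Longrightarrow> dilation a (dilation (1 / a) f) = f"
  by (auto simp: dilation_def fun_eq_iff powr_divide simp flip: of_real_mult mult.assoc)

lemma metaplectic_operator_dilation:
  assumes "a > 0"
  shows "metaplectic_operator (diag2 a (1 / a)) (dilation a)"
proof -
  have "L2_eq (dilation a f) (dilation a g)" if "f \<in> L2" "g \<in> L2" "L2_eq f g" for f g
  proof -
    have [measurable]: "f \<in> borel_measurable borel" "g \<in> borel_measurable borel"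
      using that by (auto simp: L2_def)
    have "AE x in lborel. f (0 + (1 / a) * x) = g (0 + (1 / a) * x)"
      using that assms by (intro AE_borel_affine[of "1 / a"]) (auto simp: L2_eq_def)
    then show ?thesis by (simp add: L2_eq_def dilation_def)
  qed
  moreover have "\<exists>f\<in>L2. L2_eq (dilation a f) g" if "g \<in> L2" for g
    using that assms by (intro bexI[of _ "dilation (1 / a) g"])
      (auto simp: L2_eq_def dilation_inverse intro: L2_dilation)
  ultimately have "L2_unitary (dilation a)"
    using assms unfolding L2_unitary_def
    by (auto simp: L2_dilation L2_inner_dilation)
      (auto simp: L2_eq_def dilation_def algebra_simps)
  moreover have "dilation a (weyl z f) = weyl (diag2 a (1 / a) *v z) (dilation a f)" for z f
    using assms by (auto simp: fun_eq_iff dilation_def weyl_def diag2_def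
        matrix_vector_mult_def sum_2 field_simps)
  ultimately show ?thesis
    using assms by (simp add: metaplectic_operator_def diag2_Sp2R L2_eq_def)
qed

lemma metaplectic_operator_S_tau:
  assumes "\<tau> > 0"
  shows "metaplectic_operator (S_tau \<tau>) (dilation (sqrt (coth \<tau>)))"
proof -
  have "sqrt (tanh \<tau>) = 1 / sqrt (coth \<tau>)" "sqrt (coth \<tau>) > 0"
    using assms by (simp_all add: coth_def tanh_def real_sqrt_divide)
  then show ?thesis
    using metaplectic_operator_dilation[of "sqrt (coth \<tau>)"] by (simp add: S_tau_def)
qed

end

theory Submission
  imports Defs "HOL-Probability.Characteristic_Functions"
begin

text \<open>
  Since the top coefficient of \<open>w\<close> is 1, \<open>c = 1 / \<parallel>w\<parallel>\<close>.  The inner product is invariant under the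
  rotation \<open>(z\<^sub>0 + z\<^sub>1, z\<^sub>0 - z\<^sub>1) / \<surd>2\<close>, which diagonalises the quadratic form and gives
  \<open>\<parallel>w\<parallel>\<^sup>2 = r\<^bsup>-2l\<^esup> \<Sum>\<^sub>j a\<^sub>j a\<^bsub>l-j\<^esub> / a\<^sub>l x\<^sup>j\<close> with \<open>x = exp (-4\<tau>)\<close> and \<open>a\<^sub>n = binomial(2n, n) / 4\<^sup>n\<close>.  As \<open>a\<^sub>n\<close>
  decreases and \<open>(n + 1) a\<^sub>n\<close> increases, the sum is within \<open>O(1/l)\<close> of \<open>\<Sum>\<^sub>j a\<^sub>j x\<^sup>j = (1 - x)\<^bsup>-1/2\<^esup>\<close>.

  For the matrix coefficient no uniqueness of the metaplectic operator is needed: the projection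
  onto the Gaussian is the average of the Weyl operators against a Gaussian weight, so
  \<open>|\<langle>\<Omega>, U\<Omega>\<rangle>|\<^sup>2\<close> is an integral of the coefficients \<open>\<langle>U\<Omega>, W(z) U\<Omega>\<rangle> = \<langle>\<Omega>, W(S\<^sup>-\<^sup>1z) \<Omega>\<rangle>\<close>, which
  the intertwining relation makes explicit.
\<close>

section \<open>The norm of the quadratic power\<close>

text \<open>The inner product of binary forms, dehomogenised by \<open>z\<^sub>0 = 1\<close> and restricted to real forms.\<close>

definition binomial_form :: "nat \<Rightarrow> real poly \<Rightarrow> real poly \<Rightarrow> real" where
  "binomial_form d p q = (\<Sum>k\<le>d. coeff p k * coeff q k / real (d choose k))"

lemma binomial_form_sum:
  "binomial_form d (\<Sum>i\<in>I. smult (c i) (P i)) (\<Sum>j\<in>J. smult (e j) (Q j))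
     = (\<Sum>i\<in>I. \<Sum>j\<in>J. c i * e j * binomial_form d (P i) (Q j))"
proof -
  have "binomial_form d (\<Sum>i\<in>I. smult (c i) (P i)) (\<Sum>j\<in>J. smult (e j) (Q j))
      = (\<Sum>k\<le>d. \<Sum>i\<in>I. \<Sum>j\<in>J. c i * e j * (coeff (P i) k * coeff (Q j) k / real (d choose k)))"
    unfolding binomial_form_def coeff_sum sum_product sum_divide_distrib by (simp add: mult_ac)
  also have "\<dots> = (\<Sum>i\<in>I. \<Sum>k\<le>d. \<Sum>j\<in>J. c i * e j * (coeff (P i) k * coeff (Q j) k / real (d choose k)))"
    by (rule sum.swap)
  also have "\<dots> = (\<Sum>i\<in>I. \<Sum>j\<in>J. \<Sum>k\<le>d. c i * e j * (coeff (P i) k * coeff (Q j) k / real (d choose k)))"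
    by (intro sum.cong refl sum.swap)
  finally show ?thesis by (simp add: binomial_form_def sum_distrib_left)
qed

text \<open>The weight \<open>1 / (d choose k)\<close> cancels one of the two binomial coefficients,
  and the binomial theorem remains. Powers of linear forms thus serve as generating functions for
  the pairing.\<close>

lemma binomial_form_linear_powers:
  "binomial_form d ([:a, b:] ^ d) ([:a', b':] ^ d) = (a * a' + b * b') ^ d"
proof -
  have "binomial_form d ([:a, b:] ^ d) ([:a', b':] ^ d)
      = (\<Sum>k\<le>d. real (d choose k) * (b * b') ^ k * (a * a') ^ (d - k))"
    unfolding binomial_form_def
  proof (intro sum.cong refl)
    fix k assume "k \<in> {..d}"
    then have k: "k \<le> d" by simp
    then have "real (d choose k) \<noteq> 0" by simp
    then show "coeff ([:a, b:] ^ d) k * coeff ([:a', b':] ^ d) k / real (d choose k)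
        = real (d choose k) * (b * b') ^ k * (a * a') ^ (d - k)"
      unfolding coeff_linear_poly_power[OF k] by (simp add: power_mult_distrib)
  qed
  also have "\<dots> = (b * b' + a * a') ^ d" by (simp add: binomial_ring)
  finally show ?thesis by (simp add: add.commute)
qed

text \<open>
  The monomial basis after the rotation, up to the factor \<open>2\<^bsup>d/2\<^esup>\<close>.  Its orthogonality follows by
  comparing coefficients of \<open>s\<^sup>k t\<^sup>m\<close> in the pairing of \<open>(1 + s + (1 - s) z)\<^sup>d\<close> and
  \<open>(1 + t + (1 - t) z)\<^sup>d\<close>.
\<close>
definition rotated_monomial :: "nat \<Rightarrow> nat \<Rightarrow> real poly" where
  "rotated_monomial d k = [:1, 1:] ^ (d - k) * [:1, - 1:] ^ k"

lemma binomial_form_rotated_monomial: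
  assumes "k \<le> d" "m \<le> d"
  shows "binomial_form d (rotated_monomial d k) (rotated_monomial d m)
    = (if k = m then 2 ^ d / real (d choose k) else 0)"
proof -
  define B where "B k m = binomial_form d (rotated_monomial d k) (rotated_monomial d m)" for k m
  \<comment> \<open>The base is \<open>(1 + z) + s * (1 - z)\<close>, so the powers of
    \<open>s\<close> carry the rotated monomials.\<close>
  have expand: "[:1 + s, 1 - s:] ^ d = (\<Sum>k\<le>d. smult (real (d choose k) * s ^ k) (rotated_monomial d k))" for s :: real
  proof -
    have "[:1 + s, 1 - s:] = smult s [:1, - 1:] + [:1, 1:]" by simp
    then have "[:1 + s, 1 - s:] ^ d = (smult s [:1, - 1:] + [:1, 1:]) ^ d" by (simp only:)
    also have "\<dots> = (\<Sum>k\<le>d. smult (real (d choose k) * s ^ k) (rotated_monomial d k))"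
      unfolding binomial_ring
      by (intro sum.cong refl) (simp add: rotated_monomial_def of_nat_poly smult_power mult_ac del: smult_pCons)
    finally show ?thesis .
  qed
  have "(\<Sum>k\<le>d. (real (d choose k) * (\<Sum>m\<le>d. real (d choose m) * B k m * t ^ m)) * s ^ k)
      = (\<Sum>k\<le>d. (2 ^ d * real (d choose k) * t ^ k) * s ^ k)" for s t :: real
  proof -
    have "(\<Sum>k\<le>d. (real (d choose k) * (\<Sum>m\<le>d. real (d choose m) * B k m * t ^ m)) * s ^ k)
      = binomial_form d ([:1 + s, 1 - s:] ^ d) ([:1 + t, 1 - t:] ^ d)"
      unfolding expand binomial_form_sum B_def sum_distrib_left sum_distrib_right
      by (simp add: mult_ac)
    also have "\<dots> = (2 * (s * t + 1)) ^ d"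
      unfolding binomial_form_linear_powers by (simp add: algebra_simps)
    also have "\<dots> = 2 ^ d * (s * t + 1) ^ d" by (rule power_mult_distrib)
    also have "\<dots> = (\<Sum>k\<le>d. (2 ^ d * real (d choose k) * t ^ k) * s ^ k)"
      unfolding binomial_ring sum_distrib_left by (simp add: power_mult_distrib mult_ac)
    finally show ?thesis .
  qed
  \<comment> \<open>For fixed \<open>t\<close> both sides are polynomials in \<open>s\<close>, so
    their coefficients agree; the same comparison in \<open>t\<close> then isolates
    \<open>B k m\<close>.\<close>
  then have "real (d choose k) * (\<Sum>m\<le>d. real (d choose m) * B k m * t ^ m) = 2 ^ d * real (d choose k) * t ^ k" for t
    using polyfun_eq_coeffs[of "\<lambda>k. real (d choose k) * (\<Sum>m\<le>d. real (d choose m) * B k m * t ^ m)" d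
      "\<lambda>k. 2 ^ d * real (d choose k) * t ^ k"] assms(1) by blast
  then have "(\<Sum>m\<le>d. real (d choose m) * B k m * t ^ m) = (\<Sum>m\<le>d. (if m = k then 2 ^ d else 0) * t ^ m)" for t
    using assms(1) by (simp add: if_distrib[of "\<lambda>x. x * _"] cong: if_cong)
  then have "real (d choose m) * B k m = (if m = k then 2 ^ d else 0)"
    using polyfun_eq_coeffs[of "\<lambda>m. real (d choose m) * B k m" d "\<lambda>m. if m = k then 2 ^ d else 0"] assms(2) by blast
  then show ?thesis
    using assms(2) unfolding B_def[symmetric] by (auto simp: field_simps split: if_splits)
qed

text \<open>Only the even rotated monomials \<open>2 * j\<close> occur in a power of a diagonal
  quadratic form, hence the binomial coefficients of \<open>2 * l\<close> over
  \<open>2 * j\<close>.\<close>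

definition norm_sum :: "nat \<Rightarrow> real \<Rightarrow> real" where
  "norm_sum l x = (\<Sum>j\<le>l. (real (l choose j))\<^sup>2 / real ((2 * l) choose (2 * j)) * x ^ j)"

text \<open>Since \<open>1 + 2cz + z^2 = (1-c)/2 (1-z)^2 + (1+c)/2 (1+z)^2\<close>, the power is a
  combination of mutually orthogonal rotated monomials. Its squared norm is a single sum, from which
  \<open>(1 + c) ^ (2 * l)\<close> is pulled out.\<close>

lemma binomial_form_quadratic_power:
  assumes "1 + c \<noteq> 0"
  shows "binomial_form (2 * l) ([:1, 2 * c, 1:] ^ l) ([:1, 2 * c, 1:] ^ l)
    = (1 + c) ^ (2 * l) * norm_sum l (((1 - c) / (1 + c))\<^sup>2)"
proof -
  define e where "e j = real (l choose j) * ((1 - c) / 2) ^ j * ((1 + c) / 2) ^ (l - j)" for j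
  have "[:1, 2 * c, 1:] = smult ((1 - c) / 2) ([:1, - 1:]\<^sup>2) + smult ((1 + c) / 2) ([:1, 1:]\<^sup>2)"
    by (simp add: power2_eq_square field_simps)
  then have "[:1, 2 * c, 1:] ^ l = (smult ((1 - c) / 2) ([:1, - 1:]\<^sup>2) + smult ((1 + c) / 2) ([:1, 1:]\<^sup>2)) ^ l"
    by (simp only:)
  also have "\<dots> = (\<Sum>j\<le>l. smult (e j) (rotated_monomial (2 * l) (2 * j)))"
    unfolding binomial_ring
  proof (intro sum.cong refl)
    fix j
    have "rotated_monomial (2 * l) (2 * j) = ([:1, 1:]\<^sup>2) ^ (l - j) * ([:1, - 1:]\<^sup>2) ^ j"
      by (simp only: rotated_monomial_def power_mult diff_mult_distrib2 [symmetric])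
    then show "of_nat (l choose j) * smult ((1 - c) / 2) ([:1, - 1:]\<^sup>2) ^ j * smult ((1 + c) / 2) ([:1, 1:]\<^sup>2) ^ (l - j)
        = smult (e j) (rotated_monomial (2 * l) (2 * j))"
      by (simp only: e_def of_nat_poly smult_power mult_smult_left mult_smult_right smult_smult pCons_0_0 mult_pCons_left smult_0_left mult_zero_left add_0_right mult_ac)
  qed
  finally have "binomial_form (2 * l) ([:1, 2 * c, 1:] ^ l) ([:1, 2 * c, 1:] ^ l)
    = (\<Sum>i\<le>l. \<Sum>j\<le>l. e i * e j * binomial_form (2 * l) (rotated_monomial (2 * l) (2 * i)) (rotated_monomial (2 * l) (2 * j)))"
    by (simp only: binomial_form_sum)
  also have "\<dots> = (\<Sum>i\<le>l. \<Sum>j\<le>l. if j = i then (e i)\<^sup>2 * (2 ^ (2 * l) / real ((2 * l) choose (2 * i))) else 0)"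
    by (intro sum.cong refl) (simp add: binomial_form_rotated_monomial power2_eq_square)
  also have "\<dots> = (\<Sum>i\<le>l. (e i)\<^sup>2 * (2 ^ (2 * l) / real ((2 * l) choose (2 * i))))"
    by simp
  also have "\<dots> = (\<Sum>i\<le>l. (1 + c) ^ (2 * l) * ((real (l choose i))\<^sup>2 / real ((2 * l) choose (2 * i)) * (((1 - c) / (1 + c))\<^sup>2) ^ i))"
  proof (intro sum.cong refl)
    fix i assume "i \<in> {..l}"
    then obtain k where l: "l = i + k" by (auto simp: le_iff_add)
    have "(e i)\<^sup>2 * 2 ^ (2 * l) = (real (l choose i))\<^sup>2 * ((1 - c)\<^sup>2) ^ i * ((1 + c)\<^sup>2) ^ k"
    proof -
      have "(4 :: real) ^ n = 2 ^ n * 2 ^ n" for n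
        by (simp flip: power_mult_distrib)
      then have "(m * (x / 2) ^ i * (y / 2) ^ k)\<^sup>2 * 2 ^ (2 * (i + k)) = m\<^sup>2 * (x\<^sup>2) ^ i * (y\<^sup>2) ^ k" for m x y :: real
        by (simp add: power_divide power_mult_distrib power_add power_mult power2_eq_square)
      then show ?thesis unfolding e_def l by simp
    qed
    also have "\<dots> = (1 + c) ^ (2 * l) * ((real (l choose i))\<^sup>2 * (((1 - c) / (1 + c))\<^sup>2) ^ i)"
      using assms by (simp add: l power_divide power_add power_mult field_simps)
        (simp add: power2_eq_square power_mult_distrib mult_ac)
    finally show "(e i)\<^sup>2 * (2 ^ (2 * l) / real ((2 * l) choose (2 * i)))
        = (1 + c) ^ (2 * l) * ((real (l choose i))\<^sup>2 / real ((2 * l) choose (2 * i)) * (((1 - c) / (1 + c))\<^sup>2) ^ i)"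
      by simp
  qed
  finally show ?thesis by (simp add: norm_sum_def sum_distrib_left)
qed

section \<open>The overlap in dehomogenised coordinates\<close>

lemma coeff_w_form:
  assumes "k \<le> 2 * l"
  shows "coeff (coeff (w_form l \<tau>) k) (2 * l - k) = complex_of_real (coeff ([:1, 2 * coth \<tau>, 1:] ^ l) k)"
proof -
  \<comment> \<open>Setting \<open>z0 = 1\<close> is a ring homomorphism, so it passes through the
    power by induction on \<open>l\<close>.\<close>
  have "poly (coeff (w_form l \<tau>) k) 1 = complex_of_real (coeff ([:1, 2 * coth \<tau>, 1:] ^ l) k)" for k
    unfolding w_form_def
  proof (induction l arbitrary: k)
    case 0
    show ?case by simp
  next
    case (Suc l)
    have "z0\<^sup>2 + z1\<^sup>2 + scalar_poly (complex_of_real (2 * coth \<tau>)) * z0 * z1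
        = [:[:0, 0, 1:], [:0, complex_of_real (2 * coth \<tau>):], 1:]"
      by (simp add: z0_def z1_def scalar_poly_def power2_eq_square one_pCons)
    then have factor: "poly (coeff (z0\<^sup>2 + z1\<^sup>2 + scalar_poly (complex_of_real (2 * coth \<tau>)) * z0 * z1) i) 1
        = complex_of_real (coeff [:1, 2 * coth \<tau>, 1:] i)" for i
      by (simp add: coeff_pCons split: nat.splits)
    then show ?case
      unfolding power_Suc coeff_mult poly_sum poly_mult Suc.IH factor by simp
  qed
  \<comment> \<open>By homogeneity the coefficient of \<open>z1 ^ k\<close> is a single monomial in
    \<open>z0\<close>, so evaluation at 1 loses nothing.\<close>
  moreover have "poly (coeff (w_form l \<tau>) k) 1 = coeff (coeff (w_form l \<tau>) k) (2 * l - k)"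
  proof -
    have "coeff (coeff (w_form l \<tau>) k) i = 0" if "i \<noteq> 2 * l - k" for i
      using w_form_Sym[of l \<tau>] that unfolding Sym_def
      by (metis (mono_tags, lifting) add_diff_cancel_right' mem_Collect_eq)
    then have "coeff (w_form l \<tau>) k = monom (coeff (coeff (w_form l \<tau>) k) (2 * l - k)) (2 * l - k)"
      by (intro poly_eqI) auto
    then show ?thesis by (metis mult.right_neutral poly_monom power_one)
  qed
  ultimately show ?thesis by simp
qed

lemma Sym_norm_w_form:
  "Sym_norm (2 * l) (w_form l \<tau>)
     = sqrt (binomial_form (2 * l) ([:1, 2 * coth \<tau>, 1:] ^ l) ([:1, 2 * coth \<tau>, 1:] ^ l))"
proof -
  have "Sym_inner (2 * l) (w_form l \<tau>) (w_form l \<tau>)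
      = (\<Sum>k\<le>2 * l. complex_of_real (coeff ([:1, 2 * coth \<tau>, 1:] ^ l) k * coeff ([:1, 2 * coth \<tau>, 1:] ^ l) k / real ((2 * l) choose k)))"
    unfolding Sym_inner_def by (intro sum.cong refl) (simp add: coeff_w_form)
  then show ?thesis
    by (simp add: Sym_norm_def binomial_form_def)
qed

lemma Sym_inner_u_form: "Sym_inner (2 * l) p (u_form l) = cnj (coeff (coeff p 0) (2 * l))"
proof -
  have "Sym_inner (2 * l) p (u_form l) = (\<Sum>k\<le>2 * l. if k = 0 then cnj (coeff (coeff p 0) (2 * l)) else 0)"
    using coeff_monomial[of "2 * l" 0] unfolding Sym_inner_def u_form_def by (intro sum.cong refl) auto
  then show ?thesis by simp
qed

lemma c_coeff_eq: "c_coeff l \<tau> = 1 / Sym_norm (2 * l) (w_form l \<tau>)"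
proof -
  have "Sym_norm (2 * l) (u_form l) = 1"
    using coeff_monomial[of "2 * l" 0 0 "2 * l"] by (simp add: Sym_norm_def Sym_inner_u_form) (simp add: u_form_def)
  moreover have "Sym_inner (2 * l) (w_form l \<tau>) (u_form l) = 1"
    using coeff_w_form[of 0 l \<tau>] by (simp add: Sym_inner_u_form coeff_0_power)
  moreover have "Sym_norm (2 * l) (w_form l \<tau>) \<ge> 0"
    unfolding Sym_norm_w_form by (auto simp: binomial_form_def intro!: sum_nonneg divide_nonneg_nonneg)
  moreover have "Sym_inner d (scalar_poly a * p) q = cnj a * Sym_inner d p q" for d a p q
    by (metis Sym_inner_sesquilinear(2,3) complex_cnj_mult)
  ultimately show ?thesis
    by (simp add: c_coeff_def Sym_normalize_def Sym_inner_sesquilinear(2) norm_divide)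
qed

section \<open>Asymptotics of the norm\<close>

text \<open>The Taylor coefficients of \<open>(1 - x) powr (- 1 / 2)\<close>, written with
  factorials so that the quotients in \<open>norm_sum\<close> simplify.\<close>

definition central_weight :: "nat \<Rightarrow> real" where
  "central_weight n = fact (2 * n) / (4 ^ n * (fact n)\<^sup>2)"

lemma central_weight_pos: "central_weight n > 0"
  by (simp add: central_weight_def)

lemma central_weight_Suc: "central_weight (Suc n) = central_weight n * ((2 * real n + 1) / (2 * real n + 2))"
  by (simp add: central_weight_def divide_simps power2_eq_square) (simp add: algebra_simps)

text \<open>Consecutive weights have ratio \<open>(2n + 1) / (2n + 2)\<close>, which lies between
  \<open>(n + 1) / (n + 2)\<close> and 1. The two monotonicity statements bound
  \<open>central_weight (l - j) / central_weight l\<close> from below and above.\<close>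

lemma central_weight_mono:
  assumes "m \<le> n"
  shows "central_weight n \<le> central_weight m" "(real m + 1) * central_weight m \<le> (real n + 1) * central_weight n"
proof -
  have "central_weight (Suc n) \<le> central_weight n" for n
    using central_weight_pos[of n] by (simp add: central_weight_Suc field_simps)
  then show "central_weight n \<le> central_weight m"
    using assms by (rule lift_Suc_antimono_le)
  have "(real n + 1) * central_weight n \<le> (real (Suc n) + 1) * central_weight (Suc n)" for n
  proof -
    have "real n + 1 \<le> (real n + 2) * ((2 * real n + 1) / (2 * real n + 2))"
      by (simp add: field_simps)
    then have "(real n + 1) * central_weight n \<le> (real n + 2) * ((2 * real n + 1) / (2 * real n + 2)) * central_weight n"
      using central_weight_pos[of n] by (intro mult_right_mono) auto
    then show ?thesis by (simp add: central_weight_Suc mult_ac add_ac)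
  qed
  then show "(real m + 1) * central_weight m \<le> (real n + 1) * central_weight n"
    using assms by (rule lift_Suc_mono_le[of "\<lambda>n. (real n + 1) * central_weight n"])
qed

lemma central_weight_0: "central_weight 0 = 1"
  by (simp add: central_weight_def)

text \<open>Newton's binomial series with exponent -1/2; the signs of the generalised binomial
  coefficients cancel those of the powers of \<open>- x\<close>.\<close>

lemma central_weight_sums:
  assumes "\<bar>x\<bar> < 1"
  shows "(\<lambda>n. central_weight n * x ^ n) sums ((1 - x) powr (- 1 / 2))"
proof -
  have "(- 1 / 2 :: real) gchoose n = (- 1) ^ n * central_weight n" for n
  proof (induction n)
    case (Suc n)
    have "real (Suc n) * ((- 1 / 2) gchoose Suc n) = (- 1 / 2 - real n) * ((- 1 / 2) gchoose n)"
      using gbinomial_mult_1[of "- 1 / 2 :: real" n] by (simp add: algebra_simps)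
    then show ?case
      unfolding Suc central_weight_Suc by (simp add: field_simps)
  qed (simp add: central_weight_0)
  then show ?thesis
    using gen_binomial_real[of "- x" "- 1 / 2"] assms
    by (simp add: mult_ac flip: power_mult_distrib)
qed

text \<open>Written in factorials, each quotient of binomials regroups by \<open>j\<close>,
  \<open>l - j\<close> and \<open>l\<close>, and the powers of 4 cancel.\<close>

lemma norm_sum_central_weight:
  "norm_sum l x = (\<Sum>j\<le>l. central_weight j * central_weight (l - j) / central_weight l * x ^ j)"
  unfolding norm_sum_def
proof (intro sum.cong refl)
  fix j assume "j \<in> {..l}"
  then obtain k where l: "l = j + k" by (auto simp: le_iff_add)
  have "(real (l choose j))\<^sup>2 / real ((2 * l) choose (2 * j)) = central_weight j * central_weight (l - j) / central_weight l"
  proof -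
    have "real (l choose j) = fact l / (fact j * fact k)"
      using binomial_fact[of j l, where 'a = real] by (simp add: l)
    moreover have "real ((2 * l) choose (2 * j)) = fact (2 * l) / (fact (2 * j) * fact (2 * k))"
      using binomial_fact[of "2 * j" "2 * l", where 'a = real] by (simp add: l)
    moreover have "(4 :: real) ^ l = 4 ^ j * 4 ^ k" "l - j = k"
      by (simp_all add: l power_add)
    ultimately show ?thesis
      by (simp add: central_weight_def power_divide power_mult_distrib)
  qed
  then show "(real (l choose j))\<^sup>2 / real ((2 * l) choose (2 * j)) * x ^ j = central_weight j * central_weight (l - j) / central_weight l * x ^ j"
    by simp
qed

text \<open>The term \<open>j = 0\<close> equals 1 and the others are nonnegative. This keeps the
  denominators in the asymptotics away from zero.\<close>

lemma norm_sum_ge_1: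
  assumes "x \<ge> 0"
  shows "norm_sum l x \<ge> 1"
proof -
  have "(\<Sum>j\<in>{0}. (real (l choose j))\<^sup>2 / real ((2 * l) choose (2 * j)) * x ^ j) \<le> norm_sum l x"
    unfolding norm_sum_def using assms by (intro sum_mono2) auto
  then show ?thesis by simp
qed

text \<open>For \<open>j \<le> l\<close> the ratio \<open>R\<close> lies between 1 and
  \<open>(l + 1) / (l - j + 1)\<close>; for \<open>j > l\<close> the missing weight is at most 1 and
  the bound at least 1. The bound grows polynomially in \<open>j\<close>, so it can be summed
  against a geometric series, and it decays like \<open>1 / l\<close>.\<close>

lemma norm_sum_weight_error:
  "\<bar>(if j \<le> l then central_weight j * central_weight (l - j) / central_weight l else 0) - central_weight j\<bar>
    \<le> (real j + 1) * (real j + 2) / (real l + 1)"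
proof -
  have a: "0 < central_weight j" "central_weight j \<le> 1"
    using central_weight_mono(1)[of 0 j] by (auto simp: central_weight_pos central_weight_0)
  show ?thesis
  proof (cases "j \<le> l")
    case True
    define R where "R = central_weight (l - j) / central_weight l"
    have "R \<ge> 1"
      unfolding R_def using central_weight_pos[of l] central_weight_mono(1)[of "l - j" l] by simp
    have "(real (l - j) + 1) * R \<le> real l + 1"
      unfolding R_def using central_weight_pos[of l] central_weight_mono(2)[of "l - j" l] by (simp add: field_simps)
    then have "R \<le> (real l + 1) / (real (l - j) + 1)" by (simp add: field_simps)
    \<comment> \<open>This amounts to \<open>j (l + 1) \<le> (j + 1) (j + 2) (l - j + 1)\<close>;
      with \<open>l = j + k\<close> the difference of the sides has only nonnegative
      coefficients.\<close>
    also have "\<dots> \<le> 1 + (real j + 1) * (real j + 2) / (real l + 1)"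
    proof -
      obtain k where l: "l = j + k" using True by (auto simp: le_iff_add)
      have "(real j + real k + 1) * (real j + real k + 1) \<le> (real j + real k + 1 + (real j + 1) * (real j + 2)) * (real k + 1)"
        by (simp add: algebra_simps)
      then show ?thesis by (simp add: l field_simps)
    qed
    finally have "\<bar>R - 1\<bar> \<le> (real j + 1) * (real j + 2) / (real l + 1)" using \<open>R \<ge> 1\<close> by simp
    then have "central_weight j * \<bar>R - 1\<bar> \<le> 1 * ((real j + 1) * (real j + 2) / (real l + 1))"
      using a by (intro mult_mono) auto
    moreover have "central_weight j * \<bar>R - 1\<bar> = \<bar>central_weight j * central_weight (l - j) / central_weight l - central_weight j\<bar>"
    proof -
      have "central_weight j * (R - 1) = central_weight j * central_weight (l - j) / central_weight l - central_weight j"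
        by (simp add: R_def algebra_simps)
      then show ?thesis using a by (metis abs_mult abs_of_pos)
    qed
    ultimately show ?thesis using True by simp
  next
    case False
    then have "real l + 1 \<le> (real j + 1) * 1" by simp
    also have "\<dots> \<le> (real j + 1) * (real j + 2)" by (intro mult_left_mono) auto
    finally have "1 \<le> (real j + 1) * (real j + 2) / (real l + 1)" by simp
    then have "central_weight j \<le> (real j + 1) * (real j + 2) / (real l + 1)"
      using a(2) by linarith
    then show ?thesis using a(1) False by simp
  qed
qed

lemma norm_sum_asymptotic:
  fixes x :: real
  assumes "0 \<le> x" "x < 1"
  obtains K where "\<And>l. \<bar>norm_sum l x - (1 - x) powr (- 1 / 2)\<bar> \<le> K / (real l + 1)"
proof -
  \<comment> \<open>Differentiating the geometric series twice gives the majorant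
    \<open>(j + 1) * (j + 2) * x ^ j\<close>, whose sum is the constant \<open>K\<close>.\<close>
  have g1: "summable (\<lambda>n. 1 * y ^ n)" if "norm y < 1" for y :: real
    using that by (simp add: summable_geometric)
  have g2: "summable (\<lambda>n. diffs (\<lambda>n. 1) n * y ^ n)" if "norm y < 1" for y :: real
    by (rule termdiff_converges[OF that g1])
  have g3: "summable (\<lambda>n. diffs (diffs (\<lambda>n. 1)) n * x ^ n)"
    using assms by (intro termdiff_converges[of x 1] g2) auto
  then have g: "summable (\<lambda>j. (real j + 1) * (real j + 2) * x ^ j)"
    by (simp add: diffs_def add_ac mult_ac)
  have "\<bar>norm_sum l x - (1 - x) powr (- 1 / 2)\<bar> \<le> (\<Sum>j. (real j + 1) * (real j + 2) * x ^ j) / (real l + 1)" for l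
  proof -
    \<comment> \<open>Extension by zero beyond \<open>l\<close> turns the finite sum into a series
      that can be compared term by term with that of the limit.\<close>
    define e where "e j = (if j \<le> l then central_weight j * central_weight (l - j) / central_weight l else 0)" for j
    have "(\<lambda>j. if j \<in> {..l} then e j * x ^ j else 0) sums (\<Sum>j\<in>{..l}. e j * x ^ j)"
      by (rule sums_If_finite_set) simp
    also have "(\<Sum>j\<in>{..l}. e j * x ^ j) = norm_sum l x"
      by (simp add: norm_sum_central_weight e_def)
    also have "(\<lambda>j. if j \<in> {..l} then e j * x ^ j else 0) = (\<lambda>j. e j * x ^ j)"
      by (auto simp: e_def)
    finally have "(\<lambda>j. e j * x ^ j - central_weight j * x ^ j) sums (norm_sum l x - (1 - x) powr (- 1 / 2))"
      using assms by (intro sums_diff central_weight_sums) auto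
    then have "norm_sum l x - (1 - x) powr (- 1 / 2) = (\<Sum>j. e j * x ^ j - central_weight j * x ^ j)"
      by (simp add: sums_iff)
    also have "norm \<dots> \<le> (\<Sum>j. (real j + 1) * (real j + 2) * x ^ j / (real l + 1))"
    proof (rule norm_suminf_le)
      fix j
      have "norm (e j * x ^ j - central_weight j * x ^ j) = \<bar>e j - central_weight j\<bar> * x ^ j"
        using assms by (simp add: abs_mult flip: left_diff_distrib)
      also have "\<dots> \<le> (real j + 1) * (real j + 2) / (real l + 1) * x ^ j"
        unfolding e_def using assms by (intro mult_right_mono norm_sum_weight_error) auto
      finally show "norm (e j * x ^ j - central_weight j * x ^ j) \<le> (real j + 1) * (real j + 2) * x ^ j / (real l + 1)"
        by simp
    qed (intro summable_divide g)
    also have "\<dots> = (\<Sum>j. (real j + 1) * (real j + 2) * x ^ j) / (real l + 1)"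
      by (rule suminf_divide[OF g])
    finally show ?thesis by simp
  qed
  then show ?thesis using that by blast
qed

section \<open>Closed forms of the overlap and of the constant\<close>

lemma coth_eq:
  assumes "\<tau> > 0"
  shows "coth \<tau> = (1 + exp (- 2 * \<tau>)) / (1 - exp (- 2 * \<tau>))"
proof -
  define e where "e = exp (- 2 * \<tau>)"
  have "exp (- \<tau>) = exp \<tau> * e" by (simp add: e_def flip: exp_add)
  then have *: "cosh \<tau> = exp \<tau> / 2 * (1 + e)" "sinh \<tau> = exp \<tau> / 2 * (1 - e)"
    by (simp_all add: cosh_field_def sinh_field_def field_simps)
  show ?thesis unfolding coth_def * by (simp add: e_def)
qed

text \<open>With \<open>c = coth \<tau>\<close> one has \<open>1 / (1 + c) = r_base \<tau>\<close>
  and \<open>(1 - c) / (1 + c) = - exp (- 2 * \<tau>)\<close>, whose square is the argument of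
  \<open>norm_sum\<close>.\<close>

lemma s_coeff_eq:
  assumes "\<tau> > 0"
  shows "s_coeff l \<tau> = r_base \<tau> ^ (2 * l) / norm_sum l (exp (- 4 * \<tau>))"
proof -
  define e where "e = exp (- 2 * \<tau>)"
  have e: "0 < e" "e < 1" using assms by (simp_all add: e_def)
  define c where "c = coth \<tau>"
  have c: "1 + c = 2 / (1 - e)" "1 - c = - 2 * e / (1 - e)"
    using e unfolding c_def coth_eq[OF assms] e_def[symmetric] by (simp_all add: field_simps)
  have x: "((1 - c) / (1 + c))\<^sup>2 = exp (- 4 * \<tau>)"
    using e unfolding c by (simp add: power2_eq_square) (simp add: e_def flip: exp_add)
  have r: "r_base \<tau> = 1 / (1 + c)" unfolding c by (simp add: r_base_def e_def)
  have "1 + c > 0" unfolding c using e by simp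
  moreover have "norm_sum l (exp (- 4 * \<tau>)) \<ge> 0" using norm_sum_ge_1[of "exp (- 4 * \<tau>)" l] by simp
  ultimately have "(Sym_norm (2 * l) (w_form l \<tau>))\<^sup>2 = (1 + c) ^ (2 * l) * norm_sum l (exp (- 4 * \<tau>))"
    unfolding Sym_norm_w_form c_def[symmetric] by (simp add: binomial_form_quadratic_power x)
  then show ?thesis by (simp add: s_coeff_def c_coeff_eq power_divide r)
qed

lemma C_BF_pos: "\<tau> > 0 \<Longrightarrow> C_BF \<tau> > 0"
  by (simp add: C_BF_def)

text \<open>Brings the constant to the form in which it appears both as the inverse of the limit of
  \<open>norm_sum\<close> and as the squared Gaussian coefficient.\<close>

lemma C_BF_square:
  assumes "\<tau> > 0"
  shows "(C_BF \<tau>)\<^sup>2 = sqrt (1 - exp (- 4 * \<tau>))"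
proof -
  have s: "sinh (2 * \<tau>) > 0" using assms by simp
  have "(C_BF \<tau>)\<^sup>2 = (2 * sinh (2 * \<tau>)) powr (1 / 2) * exp (- \<tau>)"
    unfolding C_BF_def power_mult_distrib by (simp add: power2_eq_square flip: powr_add exp_add)
  also have "\<dots> = sqrt (2 * sinh (2 * \<tau>)) * sqrt ((exp (- \<tau>))\<^sup>2)"
    using s by (simp add: powr_half_sqrt)
  also have "\<dots> = sqrt (2 * sinh (2 * \<tau>) * (exp (- \<tau>))\<^sup>2)"
    by (simp only: real_sqrt_mult)
  also have "2 * sinh (2 * \<tau>) * (exp (- \<tau>))\<^sup>2 = 1 - exp (- 4 * \<tau>)"
  proof -
    have "(exp (- \<tau>))\<^sup>2 = exp (- (2 * \<tau>))" by (simp flip: exp_double)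
    moreover have "exp (- (2 * \<tau>)) * exp (- (2 * \<tau>)) = exp (- 4 * \<tau>)" by (simp flip: exp_add)
    moreover have "exp (2 * \<tau>) * exp (- (2 * \<tau>)) = 1" by (simp flip: exp_add)
    ultimately show ?thesis by (simp only: sinh_field_def left_diff_distrib times_divide_eq_right nonzero_mult_div_cancel_left[of 2] zero_neq_numeral not_False_eq_True)
  qed
  finally show ?thesis .
qed

section \<open>The Gaussian matrix coefficient\<close>

lemma borel_measurable_cnj [measurable]: "cnj \<in> borel_measurable borel"
  by (intro borel_measurable_continuous_onI continuous_intros)

text \<open>The substitution \<open>y = s * (x - m)\<close> with
  \<open>s = sqrt (2 * \<alpha>)\<close> reduces the integral to the characteristic function of the
  standard normal law at \<open>p / s\<close>.\<close>

lemma gaussian_fourier: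
  fixes \<alpha> m p :: real
  assumes "\<alpha> > 0"
  shows "has_bochner_integral lborel (\<lambda>x. complex_of_real (exp (- (\<alpha> * (x - m)\<^sup>2))) * cis (p * (x - m)))
           (complex_of_real (sqrt (pi / \<alpha>) * exp (- (p\<^sup>2 / (4 * \<alpha>)))))"
proof -
  define s where "s = sqrt (2 * \<alpha>)"
  have s: "s > 0" "s\<^sup>2 = 2 * \<alpha>" using assms by (simp_all add: s_def)
  define t where "t = p / s"
  interpret real_distribution std_normal_distribution by (rule real_dist_normal_dist)
  have "integrable std_normal_distribution (\<lambda>x. iexp (t * x))"
    by (intro integrable_const_bound[of _ 1]) auto
  then have i: "integrable lborel (\<lambda>x. std_normal_density x *\<^sub>R iexp (t * x))"
    by (subst (asm) integrable_density) auto
  have "(LINT x|lborel. std_normal_density x *\<^sub>R iexp (t * x)) = char std_normal_distribution t"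
    unfolding char_def by (subst integral_density) auto
  then have "has_bochner_integral lborel (\<lambda>x. std_normal_density x *\<^sub>R iexp (t * x))
      (complex_of_real (exp (- t\<^sup>2 / 2)))"
    using i by (simp add: has_bochner_integral_iff char_std_normal_distribution)
  then have "has_bochner_integral lborel (\<lambda>x. std_normal_density (- (s * m) + s * x) *\<^sub>R iexp (t * (- (s * m) + s * x)))
      (complex_of_real (exp (- t\<^sup>2 / 2)) /\<^sub>R \<bar>s\<bar>)"
    using s by (subst (asm) lborel_has_bochner_integral_real_affine_iff[of s _ _ "- (s * m)"]) auto
  then have "has_bochner_integral lborel (\<lambda>x. sqrt (2 * pi) *\<^sub>R (std_normal_density (- (s * m) + s * x) *\<^sub>R iexp (t * (- (s * m) + s * x))))
      (sqrt (2 * pi) *\<^sub>R (complex_of_real (exp (- t\<^sup>2 / 2)) /\<^sub>R \<bar>s\<bar>))"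
    by (intro has_bochner_integral_scaleR_right) auto
  moreover have "sqrt (2 * pi) *\<^sub>R (std_normal_density (- (s * m) + s * x) *\<^sub>R iexp (t * (- (s * m) + s * x)))
      = complex_of_real (exp (- (\<alpha> * (x - m)\<^sup>2))) * cis (p * (x - m))" for x
  proof -
    have "- (s * m) + s * x = s * (x - m)" by (simp add: algebra_simps)
    moreover have "(s * (x - m))\<^sup>2 / 2 = \<alpha> * (x - m)\<^sup>2"
      by (simp add: power_mult_distrib s)
    moreover have "t * (s * (x - m)) = p * (x - m)"
      using s by (simp add: t_def)
    ultimately show ?thesis
      by (simp only: std_normal_density_def minus_divide_left [symmetric] cis_conv_exp) (simp add: scaleR_conv_of_real)
  qed
  moreover have "sqrt (2 * pi) *\<^sub>R (complex_of_real (exp (- t\<^sup>2 / 2)) /\<^sub>R \<bar>s\<bar>)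
      = complex_of_real (sqrt (pi / \<alpha>) * exp (- (p\<^sup>2 / (4 * \<alpha>))))"
  proof -
    have "sqrt (2 * pi) / s = sqrt (pi / \<alpha>)"
      using assms by (simp add: s_def real_sqrt_mult real_sqrt_divide)
    moreover have "t\<^sup>2 / 2 = p\<^sup>2 / (4 * \<alpha>)"
      using s by (simp add: t_def power_divide)
    ultimately show ?thesis
      using s by (simp add: scaleR_conv_of_real field_simps flip: of_real_mult of_real_divide)
  qed
  ultimately show ?thesis by simp
qed

lemma gaussian_integral:
  fixes \<alpha> :: real
  assumes "\<alpha> > 0"
  shows "has_bochner_integral lborel (\<lambda>x. exp (- (\<alpha> * x\<^sup>2))) (sqrt (pi / \<alpha>))"
proof -
  have "has_bochner_integral lborel (\<lambda>x. Re (complex_of_real (exp (- (\<alpha> * (x - 0)\<^sup>2))) * cis (0 * (x - 0))))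
      (Re (complex_of_real (sqrt (pi / \<alpha>) * exp (- (0\<^sup>2 / (4 * \<alpha>))))))"
    using gaussian_fourier[OF assms, of 0 0] by (intro has_bochner_integral_Re)
  then show ?thesis by simp
qed

section \<open>Square-integrable functions and Weyl operators\<close>

lemma L2_measurable: "f \<in> L2 \<Longrightarrow> f \<in> borel_measurable borel"
  by (simp add: L2_def)

lemma integrable_cnj_mult_L2:
  assumes "f \<in> L2" "g \<in> L2"
  shows "integrable lborel (\<lambda>x. cnj (f x) * g x)"
proof (rule Bochner_Integration.integrable_bound)
  note [measurable] = assms[THEN L2_measurable]
  show "integrable lborel (\<lambda>x. (cmod (f x))\<^sup>2 + (cmod (g x))\<^sup>2)"
    using assms by (auto simp: L2_def)
  show "(\<lambda>x. cnj (f x) * g x) \<in> borel_measurable lborel"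
    by measurable
  have "a * b \<le> a\<^sup>2 + b\<^sup>2" for a b :: real
  proof -
    have "2 * (a * b) \<le> a\<^sup>2 + b\<^sup>2" using sum_squares_bound[of a b] by (simp add: mult.assoc)
    then show ?thesis using zero_le_power2[of a] zero_le_power2[of b] by linarith
  qed
  then show "AE x in lborel. norm (cnj (f x) * g x) \<le> norm ((cmod (f x))\<^sup>2 + (cmod (g x))\<^sup>2)"
    by (auto simp: norm_mult)
qed

lemma gaussian_L2: "\<Omega> \<in> L2"
proof -
  have "integrable lborel (\<lambda>x. (pi powr (- 1 / 4))\<^sup>2 * exp (- (1 * x\<^sup>2)))"
    using gaussian_integral[of 1] by (auto simp: has_bochner_integral_iff)
  also have "(\<lambda>x. (pi powr (- 1 / 4))\<^sup>2 * exp (- (1 * x\<^sup>2))) = (\<lambda>x. (cmod (\<Omega> x))\<^sup>2)"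
    by (auto simp: \<Omega>_def norm_mult power_mult_distrib simp flip: exp_double)
  finally have "integrable lborel (\<lambda>x. (cmod (\<Omega> x))\<^sup>2)" .
  moreover have "\<Omega> \<in> borel_measurable borel"
    unfolding \<Omega>_def [abs_def] by measurable
  ultimately show ?thesis by (simp add: L2_def)
qed

lemma integrable_translate:
  fixes f :: "real \<Rightarrow> 'a :: {banach, second_countable_topology}"
  assumes "integrable lborel f"
  shows "integrable lborel (\<lambda>x. f (x - q))"
  using lborel_integrable_real_affine[OF assms, of 1 "- q"] by simp

lemma translate_L2: "f \<in> L2 \<Longrightarrow> (\<lambda>x. f (x - q)) \<in> L2"
  using integrable_translate[of "\<lambda>x. (cmod (f x))\<^sup>2" q] by (auto simp: L2_def)

lemma weyl_L2:
  assumes "f \<in> L2"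
  shows "weyl z f \<in> L2"
proof -
  note [measurable] = L2_measurable[OF assms]
  show ?thesis
    using translate_L2[OF assms, of "z $ 1"] unfolding L2_def weyl_def
    by (auto simp: norm_mult cis_conv_exp)
qed

text \<open>Completing the square centres the product of the two Gaussians at \<open>q / 2\<close>.
  The phase of the Weyl operator is centred at the same point, so the Fourier integral is
  real.\<close>

lemma weyl_gaussian_coefficient:
  "L2_inner \<Omega> (weyl (vector [q, p]) \<Omega>) = complex_of_real (exp (- ((q\<^sup>2 + p\<^sup>2) / 4)))"
proof -
  have pi4: "pi powr (- 1 / 4) * pi powr (- 1 / 4) = 1 / sqrt pi"
    by (simp add: powr_minus_divide powr_half_sqrt flip: powr_add)
  have "cnj (\<Omega> x) * weyl (vector [q, p]) \<Omega> x = complex_of_real (exp (- (q\<^sup>2 / 4)) / sqrt pi) *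
      (complex_of_real (exp (- (1 * (x - q / 2)\<^sup>2))) * cis (p * (x - q / 2)))" for x
  proof -
    have "- x\<^sup>2 / 2 + - (x - q)\<^sup>2 / 2 = - (q\<^sup>2 / 4) + - (x - q / 2)\<^sup>2"
      by (simp add: power2_eq_square field_simps)
    then have e: "exp (- x\<^sup>2 / 2) * exp (- (x - q)\<^sup>2 / 2) = exp (- (q\<^sup>2 / 4)) * exp (- (x - q / 2)\<^sup>2)"
      by (simp flip: exp_add)
    have "(pi powr (- 1 / 4) * exp (- x\<^sup>2 / 2)) * (pi powr (- 1 / 4) * exp (- (x - q)\<^sup>2 / 2))
        = (pi powr (- 1 / 4) * pi powr (- 1 / 4)) * (exp (- x\<^sup>2 / 2) * exp (- (x - q)\<^sup>2 / 2))"
      by (simp only: mult_ac)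
    also have "\<dots> = exp (- (q\<^sup>2 / 4)) / sqrt pi * exp (- (x - q / 2)\<^sup>2)"
      unfolding e pi4 by simp
    finally have "complex_of_real ((pi powr (- 1 / 4) * exp (- x\<^sup>2 / 2)) * (pi powr (- 1 / 4) * exp (- (x - q)\<^sup>2 / 2)))
        * cis (p * (x - q / 2))
        = complex_of_real (exp (- (q\<^sup>2 / 4)) / sqrt pi * exp (- (x - q / 2)\<^sup>2)) * cis (p * (x - q / 2))"
      by simp
    moreover have "p * x - q * p / 2 = p * (x - q / 2)" by (simp add: algebra_simps)
    ultimately show ?thesis
      unfolding \<Omega>_def weyl_def vector_2 by (simp add: mult_ac)
  qed
  then have "L2_inner \<Omega> (weyl (vector [q, p]) \<Omega>) = complex_of_real (exp (- (q\<^sup>2 / 4)) / sqrt pi) *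
      (LINT x|lborel. complex_of_real (exp (- (1 * (x - q / 2)\<^sup>2))) * cis (p * (x - q / 2)))"
    unfolding L2_inner_def by simp
  also have "(LINT x|lborel. complex_of_real (exp (- (1 * (x - q / 2)\<^sup>2))) * cis (p * (x - q / 2)))
      = complex_of_real (sqrt (pi / 1) * exp (- (p\<^sup>2 / (4 * 1))))"
    using gaussian_fourier[of 1 "q / 2" p] by (simp only: has_bochner_integral_iff)
  also have "complex_of_real (exp (- (q\<^sup>2 / 4)) / sqrt pi) * \<dots> = complex_of_real (exp (- (q\<^sup>2 / 4)) * exp (- (p\<^sup>2 / 4)))"
    unfolding of_real_mult [symmetric] by simp
  also have "exp (- (q\<^sup>2 / 4)) * exp (- (p\<^sup>2 / 4)) = exp (- ((q\<^sup>2 + p\<^sup>2) / 4))"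
    by (simp add: add_divide_distrib flip: exp_add)
  finally show ?thesis .
qed

text \<open>After Fubini the inner integral over \<open>q\<close> is independent of
  \<open>x\<close>, by reflection and translation invariance, so the double integral
  factors.\<close>

lemma integral_convolution_square:
  fixes k :: "real \<Rightarrow> complex"
  assumes k: "integrable lborel k"
  shows "(LINT q|lborel. LINT x|lborel. cnj (k x) * k (x - q)) = complex_of_real ((cmod (LINT x|lborel. k x))\<^sup>2)"
proof -
  have [measurable]: "k \<in> borel_measurable borel" using k by auto
  have flip: "(LINT q|lborel. f (x - q)) = (LINT q|lborel. f q)"
    for x :: real and f :: "real \<Rightarrow> 'b :: {banach, second_countable_topology}"
    using lborel_integral_real_affine[of "- 1" f x] by simp
  have iflip: "integrable lborel (\<lambda>q. f (x - q))" if "integrable lborel f"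
    for x :: real and f :: "real \<Rightarrow> 'b :: {banach, second_countable_topology}"
    using lborel_integrable_real_affine[OF that, of "- 1" x] by simp
  have "integrable (lborel \<Otimes>\<^sub>M lborel) (case_prod (\<lambda>x q. cnj (k x) * k (x - q)))"
  proof (rule lborel_pair.Fubini_integrable)
    have "(\<lambda>x. LINT q|lborel. cmod (k x) * cmod (k (x - q))) = (\<lambda>x. cmod (k x) * (LINT q|lborel. cmod (k q)))"
      by (simp add: flip[of "\<lambda>q. cmod (k q)"])
    then show "integrable lborel (\<lambda>x. LINT q|lborel. norm (case (x, q) of (x, q) \<Rightarrow> cnj (k x) * k (x - q)))"
      using k by (simp add: norm_mult)
    show "AE x in lborel. integrable lborel (\<lambda>q. case (x, q) of (x, q) \<Rightarrow> cnj (k x) * k (x - q))"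
      using iflip[OF k] by simp
  qed measurable
  from lborel_pair.Fubini_integral[OF this]
  have "(LINT q|lborel. LINT x|lborel. cnj (k x) * k (x - q)) = (LINT x|lborel. LINT q|lborel. cnj (k x) * k (x - q))" .
  also have "\<dots> = (LINT x|lborel. cnj (k x) * (LINT x|lborel. k x))"
    by (simp add: flip[of k])
  also have "\<dots> = (LINT x|lborel. cnj (k x)) * (LINT x|lborel. k x)"
    by simp
  also have "(LINT x|lborel. cnj (k x)) = cnj (LINT x|lborel. k x)"
    by simp
  finally show ?thesis
    by (simp only: complex_norm_square mult.commute)
qed

text \<open>
  Integrating over \<open>p\<close> first replaces the phase by \<open>exp (-(x - q/2)\<^sup>2)\<close>; together with \<open>exp (-q\<^sup>2/4)\<close>
  this factors as \<open>exp (-x\<^sup>2/2) exp (-(x - q)\<^sup>2/2)\<close>, so that a convolution square remains.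
\<close>
lemma gaussian_average_weyl_coefficient:
  assumes g: "g \<in> L2"
  shows "(LINT q|lborel. complex_of_real (exp (- (q\<^sup>2 / 4))) *
      (LINT p|lborel. complex_of_real (exp (- (p\<^sup>2 / 4))) * L2_inner g (weyl (vector [q, p]) g)))
    = complex_of_real (2 * pi * (cmod (L2_inner \<Omega> g))\<^sup>2)"
proof -
  note [measurable] = L2_measurable[OF g]
  define k where "k x = complex_of_real (exp (- x\<^sup>2 / 2)) * g x" for x
  have \<Omega>k: "cnj (\<Omega> x) * g x = complex_of_real (pi powr (- 1 / 4)) * k x" for x
    by (simp add: \<Omega>_def k_def)
  have "integrable lborel (\<lambda>x. complex_of_real (pi powr (1 / 4)) * (cnj (\<Omega> x) * g x))"
    using integrable_cnj_mult_L2[OF gaussian_L2 g] by simp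
  also have "(\<lambda>x. complex_of_real (pi powr (1 / 4)) * (cnj (\<Omega> x) * g x)) = k"
    unfolding \<Omega>k mult.assoc[symmetric] of_real_mult[symmetric] by (simp flip: powr_add)
  finally have k: "integrable lborel k" .
  have "(LINT p|lborel. complex_of_real (exp (- (p\<^sup>2 / 4))) * L2_inner g (weyl (vector [q, p]) g))
      = (LINT x|lborel. cnj (g x) * g (x - q) * complex_of_real (2 * sqrt pi * exp (- (x - q / 2)\<^sup>2)))" for q
  proof -
    let ?h = "\<lambda>x. cnj (g x) * g (x - q)"
    have h: "integrable lborel ?h"
      using integrable_cnj_mult_L2[OF g translate_L2[OF g]] .
    \<comment> \<open>Here \<open>p\<close> is the variable of integration and
      \<open>x - q / 2\<close> the frequency; \<open>p - 0\<close> matches the shape of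
      \<open>gaussian_fourier\<close>.\<close>
    let ?f = "\<lambda>x p. ?h x * (complex_of_real (exp (- (1/4 * (p - 0)\<^sup>2))) * cis ((x - q / 2) * (p - 0)))"
    have G: "has_bochner_integral lborel (\<lambda>p. complex_of_real (exp (- (1/4 * (p - 0)\<^sup>2))) * cis ((x - q / 2) * (p - 0)))
       (complex_of_real (sqrt (pi / (1/4)) * exp (- ((x - q / 2)\<^sup>2 / (4 * (1/4))))))" for x
      by (rule gaussian_fourier) simp
    \<comment> \<open>The phase has modulus 1, so the absolute value is an integrable function of
      \<open>x\<close> times a Gaussian in \<open>p\<close>.\<close>
    have "integrable (lborel \<Otimes>\<^sub>M lborel) (case_prod ?f)"
    proof (rule lborel_pair.Fubini_integrable)
      have "integrable lborel (\<lambda>x. cmod (?h x) * (LINT p|lborel. exp (- (1/4 * p\<^sup>2))))"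
        using h by (intro integrable_mult_left integrable_norm)
      then show "integrable lborel (\<lambda>x. LINT p|lborel. norm (case (x, p) of (x, p) \<Rightarrow> ?f x p))"
        by (simp add: norm_mult)
      show "AE x in lborel. integrable lborel (\<lambda>p. case (x, p) of (x, p) \<Rightarrow> ?f x p)"
        unfolding prod.case using G by (intro AE_I2 integrable_mult_right) (auto simp: has_bochner_integral_iff)
    qed (unfold cis_conv_exp, measurable)
    from lborel_pair.Fubini_integral[OF this]
    have "(LINT p|lborel. LINT x|lborel. ?f x p) = (LINT x|lborel. LINT p|lborel. ?f x p)" .
    also have "\<dots> = (LINT x|lborel. ?h x * complex_of_real (sqrt (pi / (1/4)) * exp (- ((x - q / 2)\<^sup>2 / (4 * (1/4))))))"
      by (intro Bochner_Integration.integral_cong refl)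
        (use G in \<open>simp only: has_bochner_integral_iff integral_mult_right_zero\<close>)
    also have "\<dots> = (LINT x|lborel. ?h x * complex_of_real (2 * sqrt pi * exp (- (x - q / 2)\<^sup>2)))"
      by (simp add: real_sqrt_mult mult_ac)
    finally have "(LINT p|lborel. LINT x|lborel. ?f x p) = \<dots>" .
    moreover have "(LINT x|lborel. ?f x p) = complex_of_real (exp (- (p\<^sup>2 / 4))) * L2_inner g (weyl (vector [q, p]) g)" for p
    proof -
      have "?f x p = complex_of_real (exp (- (p\<^sup>2 / 4))) * (cnj (g x) * weyl (vector [q, p]) g x)" for x
        by (simp add: weyl_def algebra_simps)
      then show ?thesis unfolding L2_inner_def by (simp only: integral_mult_right_zero)
    qed
    ultimately show ?thesis by simp
  qed
  then have "(LINT q|lborel. complex_of_real (exp (- (q\<^sup>2 / 4))) *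
      (LINT p|lborel. complex_of_real (exp (- (p\<^sup>2 / 4))) * L2_inner g (weyl (vector [q, p]) g)))
    = (LINT q|lborel. LINT x|lborel. complex_of_real (exp (- (q\<^sup>2 / 4))) *
       (cnj (g x) * g (x - q) * complex_of_real (2 * sqrt pi * exp (- (x - q / 2)\<^sup>2))))"
    by simp
  also have "\<dots> = (LINT q|lborel. LINT x|lborel. complex_of_real (2 * sqrt pi) * (cnj (k x) * k (x - q)))"
  proof -
    have "complex_of_real (exp (- (q\<^sup>2 / 4))) *
       (cnj (g x) * g (x - q) * complex_of_real (2 * sqrt pi * exp (- (x - q / 2)\<^sup>2)))
       = complex_of_real (2 * sqrt pi) * (cnj (k x) * k (x - q))" for q x
    proof -
      have "- (q\<^sup>2 / 4) + - (x - q / 2)\<^sup>2 = - x\<^sup>2 / 2 + - (x - q)\<^sup>2 / 2"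
        by (simp add: power2_eq_square field_simps)
      then have "exp (- (q\<^sup>2 / 4)) * exp (- (x - q / 2)\<^sup>2) = exp (- x\<^sup>2 / 2) * exp (- (x - q)\<^sup>2 / 2)"
        by (simp flip: exp_add)
      then have e: "complex_of_real (exp (- (q\<^sup>2 / 4))) * complex_of_real (exp (- (x - q / 2)\<^sup>2))
          = complex_of_real (exp (- x\<^sup>2 / 2)) * complex_of_real (exp (- (x - q)\<^sup>2 / 2))"
        by (simp flip: of_real_mult)
      have "complex_of_real (exp (- (q\<^sup>2 / 4))) *
       (cnj (g x) * g (x - q) * complex_of_real (2 * sqrt pi * exp (- (x - q / 2)\<^sup>2)))
       = complex_of_real (2 * sqrt pi) * (cnj (g x) * g (x - q)) *
         (complex_of_real (exp (- (q\<^sup>2 / 4))) * complex_of_real (exp (- (x - q / 2)\<^sup>2)))"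
        unfolding of_real_mult by (simp only: mult_ac)
      also have "\<dots> = complex_of_real (2 * sqrt pi) * (cnj (k x) * k (x - q))"
        unfolding e k_def complex_cnj_mult complex_cnj_complex_of_real by (simp only: mult_ac)
      finally show ?thesis .
    qed
    then show ?thesis by (simp only:)
  qed
  also have "\<dots> = complex_of_real (2 * sqrt pi) * complex_of_real ((cmod (LINT x|lborel. k x))\<^sup>2)"
    unfolding integral_mult_right_zero integral_convolution_square[OF k] ..
  also have "\<dots> = complex_of_real (2 * pi * (cmod (L2_inner \<Omega> g))\<^sup>2)"
  proof -
    \<comment> \<open>The prefactor of \<open>\<Omega>\<close> has square
      \<open>1 / sqrt pi\<close>, which accounts for the passage from \<open>2 * sqrt pi\<close> to
      \<open>2 * pi\<close>.\<close>
    have "cmod (L2_inner \<Omega> g) = pi powr (- 1 / 4) * cmod (LINT x|lborel. k x)"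
      unfolding L2_inner_def \<Omega>k integral_mult_right_zero norm_mult by simp
    moreover have "(pi powr (- 1 / 4))\<^sup>2 = 1 / sqrt pi"
      by (simp add: power2_eq_square powr_minus_divide powr_half_sqrt flip: powr_add)
    ultimately have "pi * (cmod (L2_inner \<Omega> g))\<^sup>2 = pi / sqrt pi * (cmod (LINT x|lborel. k x))\<^sup>2"
      by (simp add: power_mult_distrib)
    also have "pi / sqrt pi = sqrt pi"
      by (simp add: real_div_sqrt)
    finally show ?thesis by (simp only: mult.assoc of_real_mult [symmetric])
  qed
  finally show ?thesis .
qed

section \<open>Gaussian coefficients of metaplectic operators\<close>

lemma metaplectic_weyl_coefficient:
  assumes U: "metaplectic_operator S U" and f: "f \<in> L2"
  shows "L2_inner (U f) (weyl (S *v z) (U f)) = L2_inner f (weyl z f)"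
proof -
  have u: "L2_unitary U" and cov: "L2_eq (U (weyl z f)) (weyl (S *v z) (U f))"
    using U f by (auto simp: metaplectic_operator_def)
  have Uf: "U f \<in> L2" "U (weyl z f) \<in> L2" "weyl (S *v z) (U f) \<in> L2"
    using u f weyl_L2 by (auto simp: L2_unitary_def)
  note [measurable] = Uf[THEN L2_measurable]
  \<comment> \<open>Intertwining moves \<open>U\<close> outside the Weyl operator almost everywhere;
    unitarity then removes it.\<close>
  have "L2_inner (U f) (weyl (S *v z) (U f)) = L2_inner (U f) (U (weyl z f))"
    unfolding L2_inner_def
  proof (intro integral_cong_AE)
    show "AE x in lborel. cnj (U f x) * weyl (S *v z) (U f) x = cnj (U f x) * U (weyl z f) x"
      using cov by (auto simp: L2_eq_def)
  qed measurable
  also have "\<dots> = L2_inner f (weyl z f)"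
    using u f weyl_L2[OF f] by (simp add: L2_unitary_def)
  finally show ?thesis .
qed

text \<open>As \<open>diag2 a b\<close> has inverse \<open>diag2 b a\<close>, the Weyl coefficients
  of \<open>U \<Omega>\<close> are Gaussian in \<open>b * q\<close> and \<open>a * p\<close>. Their
  average is \<open>2 * pi\<close> times the square sought, and it separates into two
  one-dimensional integrals.\<close>

lemma metaplectic_gaussian_coefficient:
  assumes U: "metaplectic_operator (diag2 a b) U" and ab: "a > 0" "b > 0" "a * b = 1"
  shows "(cmod (L2_inner \<Omega> (U \<Omega>)))\<^sup>2 = 2 / (a + b)"
proof -
  let ?g = "U \<Omega>"
  have g: "?g \<in> L2"
    using U gaussian_L2 by (auto simp: metaplectic_operator_def L2_unitary_def)
  have A: "L2_inner ?g (weyl (vector [q, p]) ?g) = complex_of_real (exp (- (b\<^sup>2 * q\<^sup>2 / 4)) * exp (- (a\<^sup>2 * p\<^sup>2 / 4)))" for q p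
  proof -
    have 1: "a * (b * q) = q" "b * (a * p) = p"
      using ab(3) by (simp_all add: mult.assoc[symmetric] mult.commute)
    have "diag2 a b *v vector [b * q, a * p] = vector [q, p]"
      by (simp add: vec_eq_iff forall_2 diag2_def matrix_vector_mult_def sum_2 1)
    then have "L2_inner ?g (weyl (vector [q, p]) ?g) = L2_inner \<Omega> (weyl (vector [b * q, a * p]) \<Omega>)"
      using metaplectic_weyl_coefficient[OF U gaussian_L2, of "vector [b * q, a * p]"] by simp
    also have "\<dots> = complex_of_real (exp (- (((b * q)\<^sup>2 + (a * p)\<^sup>2) / 4)))"
      by (rule weyl_gaussian_coefficient)
    also have "exp (- (((b * q)\<^sup>2 + (a * p)\<^sup>2) / 4)) = exp (- (b\<^sup>2 * q\<^sup>2 / 4)) * exp (- (a\<^sup>2 * p\<^sup>2 / 4))"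
      by (simp add: power_mult_distrib add_divide_distrib flip: exp_add)
    finally show ?thesis .
  qed
  have I: "(LINT x|lborel. exp (- ((1 + c\<^sup>2) / 4 * x\<^sup>2))) = 2 * sqrt (pi / (1 + c\<^sup>2))" for c :: real
  proof -
    have "has_bochner_integral lborel (\<lambda>x. exp (- ((1 + c\<^sup>2) / 4 * x\<^sup>2))) (sqrt (pi / ((1 + c\<^sup>2) / 4)))"
      by (rule gaussian_integral) (simp add: add_pos_nonneg)
    then show ?thesis
      by (simp add: has_bochner_integral_iff real_sqrt_divide real_sqrt_mult)
  qed
  have m: "exp (- (x\<^sup>2 / 4)) * exp (- (c\<^sup>2 * x\<^sup>2 / 4)) = exp (- ((1 + c\<^sup>2) / 4 * x\<^sup>2))" for c x :: real
    by (simp add: algebra_simps add_divide_distrib flip: exp_add)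
  have "complex_of_real (2 * pi * (cmod (L2_inner \<Omega> ?g))\<^sup>2) =
    (LINT q|lborel. complex_of_real (exp (- (q\<^sup>2 / 4))) *
      (LINT p|lborel. complex_of_real (exp (- (p\<^sup>2 / 4))) *
        complex_of_real (exp (- (b\<^sup>2 * q\<^sup>2 / 4)) * exp (- (a\<^sup>2 * p\<^sup>2 / 4)))))"
    unfolding gaussian_average_weyl_coefficient[OF g, symmetric] A ..
  also have "\<dots> = complex_of_real (LINT q|lborel. exp (- (q\<^sup>2 / 4)) *
      (LINT p|lborel. exp (- (p\<^sup>2 / 4)) * (exp (- (b\<^sup>2 * q\<^sup>2 / 4)) * exp (- (a\<^sup>2 * p\<^sup>2 / 4)))))"
    by (simp only: of_real_mult[symmetric] integral_complex_of_real)
  also have "(LINT q|lborel. exp (- (q\<^sup>2 / 4)) *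
      (LINT p|lborel. exp (- (p\<^sup>2 / 4)) * (exp (- (b\<^sup>2 * q\<^sup>2 / 4)) * exp (- (a\<^sup>2 * p\<^sup>2 / 4)))))
    = (LINT q|lborel. exp (- ((1 + b\<^sup>2) / 4 * q\<^sup>2)) * (LINT p|lborel. exp (- ((1 + a\<^sup>2) / 4 * p\<^sup>2))))"
    unfolding m[symmetric] by (simp add: mult.left_commute[of "exp (- (x\<^sup>2 / 4))" for x] mult.assoc)
  also have "\<dots> = (2 * sqrt (pi / (1 + b\<^sup>2))) * (2 * sqrt (pi / (1 + a\<^sup>2)))"
    unfolding integral_mult_left_zero I ..
  also have "\<dots> = 4 * pi / (a + b)"
  proof -
    \<comment> \<open>Because \<open>a * b = 1\<close>, the terms \<open>1\<close> and
      \<open>a^2 b^2\<close> add up to \<open>2 * a * b\<close>.\<close>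
    have "(1 + b\<^sup>2) * (1 + a\<^sup>2) = (a + b)\<^sup>2"
    proof -
      have "b\<^sup>2 * a\<^sup>2 = 1" using ab(3) by (metis mult.commute one_power2 power_mult_distrib)
      then show ?thesis using ab(3) by (simp add: power2_sum algebra_simps)
    qed
    then have "sqrt (1 + b\<^sup>2) * sqrt (1 + a\<^sup>2) = a + b"
      using ab by (simp flip: real_sqrt_mult)
    then show ?thesis by (simp add: real_sqrt_divide)
  qed
  finally have "2 * pi * (cmod (L2_inner \<Omega> ?g))\<^sup>2 = 4 * pi / (a + b)"
    by (simp only: of_real_eq_iff)
  then have "pi * (2 * (cmod (L2_inner \<Omega> ?g))\<^sup>2) = pi * (4 / (a + b))" by (simp add: mult_ac)
  then have "2 * (cmod (L2_inner \<Omega> ?g))\<^sup>2 = 4 / (a + b)" by (subst (asm) mult_cancel_left) simp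
  then show ?thesis by simp
qed

text \<open>Here \<open>a = sqrt ((1 + e) / (1 - e))\<close> and \<open>b\<close> is its inverse, so
  \<open>a + b = 2 / sqrt (1 - e^2)\<close> with \<open>e^2 = exp (- 4 * \<tau>)\<close>.\<close>

lemma S_tau_gaussian_coefficient:
  assumes "\<tau> > 0" "metaplectic_operator (S_tau \<tau>) U"
  shows "(cmod (L2_inner \<Omega> (U \<Omega>)))\<^sup>2 = sqrt (1 - exp (- 4 * \<tau>))"
proof -
  define e where "e = exp (- 2 * \<tau>)"
  have e: "0 < e" "e < 1" using assms by (simp_all add: e_def)
  have e2: "exp (- 4 * \<tau>) = e\<^sup>2" by (simp add: e_def flip: exp_double)
  define a b where "a = sqrt (coth \<tau>)" and "b = sqrt (tanh \<tau>)"
  have "coth \<tau> = (1 + e) / (1 - e)" using coth_eq[OF assms(1)] by (simp add: e_def)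
  moreover have "tanh \<tau> = 1 / coth \<tau>" by (simp add: tanh_def coth_def)
  ultimately have ab: "a = sqrt (1 + e) / sqrt (1 - e)" "b = sqrt (1 - e) / sqrt (1 + e)"
    by (simp_all add: a_def b_def real_sqrt_divide)
  have "(cmod (L2_inner \<Omega> (U \<Omega>)))\<^sup>2 = 2 / (a + b)"
  proof (rule metaplectic_gaussian_coefficient)
    show "metaplectic_operator (diag2 a b) U"
      using assms(2) by (simp add: S_tau_def a_def b_def)
  qed (use e in \<open>simp_all add: ab\<close>)
  also have "a + b = ((sqrt (1 + e))\<^sup>2 + (sqrt (1 - e))\<^sup>2) / (sqrt (1 + e) * sqrt (1 - e))"
    using e by (simp add: ab field_simps power2_eq_square)
  also have "\<dots> = 2 / (sqrt (1 + e) * sqrt (1 - e))" using e by simp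
  also have "2 / \<dots> = sqrt ((1 + e) * (1 - e))" by (simp add: real_sqrt_mult)
  also have "(1 + e) * (1 - e) = 1 - exp (- 4 * \<tau>)"
    unfolding e2 by (simp add: power2_eq_square algebra_simps)
  finally show ?thesis .
qed

section \<open>Relative errors and identification of the constant\<close>

theorem theorem12p6:
  fixes \<tau> :: real
  assumes "\<tau> > 0"
  shows "(\<exists>\<epsilon> :: nat \<Rightarrow> real. \<epsilon> \<in> O(\<lambda>l. 1 / real l) \<and>
            (\<forall>l. c_coeff l \<tau> = C_BF \<tau> * r_base \<tau> ^ l * (1 + \<epsilon> l))) \<and>
         (\<exists>\<epsilon> :: nat \<Rightarrow> real. \<epsilon> \<in> O(\<lambda>l. 1 / real l) \<and>
            (\<forall>l. s_coeff l \<tau> = (C_BF \<tau>)\<^sup>2 * r_base \<tau> ^ (2 * l) * (1 + \<epsilon> l))) \<and>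
         S_tau \<tau> \<in> Sp2R \<and>
         (\<forall>U. metaplectic_operator (S_tau \<tau>) U \<longrightarrow> C_BF \<tau> = cmod (L2_inner \<Omega> (U \<Omega>)))"
proof -
  define x where "x = exp (- 4 * \<tau>)"
  have x: "0 < x" "x < 1" using assms by (simp_all add: x_def)
  define S where "S = (1 - x) powr (- 1 / 2)"
  have S: "S = 1 / sqrt (1 - x)" using x by (simp add: S_def powr_minus_divide powr_half_sqrt)
  obtain K where K: "\<And>l. \<bar>norm_sum l x - S\<bar> \<le> K / (real l + 1)"
    using norm_sum_asymptotic[of x] x unfolding S_def by auto
  have "K \<ge> 0" using K[of 0] by simp
  have F: "norm_sum l x \<ge> 1" for l using x by (intro norm_sum_ge_1) simp
  \<comment> \<open>The relative error is chosen so that the formula for \<open>s_coeff\<close> is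
    exact for every \<open>l\<close>; only its size has to be estimated.\<close>
  define \<delta> where "\<delta> l = S / norm_sum l x - 1" for l
  have \<delta>_pos: "1 + \<delta> l > 0" for l
    using F[of l] x by (simp add: \<delta>_def S)
  have \<delta>_le: "\<bar>\<delta> l\<bar> \<le> K * (1 / real l)" if "l > 0" for l
  proof -
    have "\<delta> l = (S - norm_sum l x) / norm_sum l x"
      using F[of l] by (simp add: \<delta>_def diff_divide_distrib)
    then have "\<bar>\<delta> l\<bar> = \<bar>norm_sum l x - S\<bar> / norm_sum l x"
      using F[of l] by (simp add: abs_minus_commute)
    also have "\<dots> \<le> \<bar>norm_sum l x - S\<bar> / 1"
      using F[of l] by (intro divide_left_mono) auto
    also have "\<dots> \<le> K / (real l + 1)" using K[of l] by simp
    also have "\<dots> \<le> K / real l"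
      using that \<open>K \<ge> 0\<close> by (intro divide_left_mono) auto
    finally show ?thesis by simp
  qed
  have s: "s_coeff l \<tau> = (C_BF \<tau>)\<^sup>2 * r_base \<tau> ^ (2 * l) * (1 + \<delta> l)" for l
    unfolding s_coeff_eq[OF assms] C_BF_square[OF assms] x_def[symmetric] \<delta>_def S using x by simp
  \<comment> \<open>At \<open>l = 0\<close> the comparison function takes the default value 0, so
    the estimate starts at \<open>l = 1\<close>.\<close>
  have "\<delta> \<in> O(\<lambda>l. 1 / real l)"
    using \<delta>_le by (intro bigoI[of _ K] eventually_sequentiallyI[of 1]) auto
  with s have part2: "\<exists>\<epsilon> :: nat \<Rightarrow> real. \<epsilon> \<in> O(\<lambda>l. 1 / real l) \<and>
      (\<forall>l. s_coeff l \<tau> = (C_BF \<tau>)\<^sup>2 * r_base \<tau> ^ (2 * l) * (1 + \<epsilon> l))"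
    by blast
  \<comment> \<open>Taking the square root of the factor \<open>1 + \<delta> l\<close> passes from
    \<open>s_coeff\<close> to \<open>c_coeff\<close>; as both sides are nonnegative, comparing
    squares suffices.\<close>
  define \<epsilon> where "\<epsilon> l = sqrt (1 + \<delta> l) - 1" for l
  have c: "c_coeff l \<tau> = C_BF \<tau> * r_base \<tau> ^ l * (1 + \<epsilon> l)" for l
  proof (rule power2_eq_imp_eq)
    have "(c_coeff l \<tau>)\<^sup>2 = (C_BF \<tau>)\<^sup>2 * r_base \<tau> ^ (2 * l) * (1 + \<delta> l)"
      using s[of l] by (simp add: s_coeff_def)
    also have "\<dots> = (C_BF \<tau> * r_base \<tau> ^ l * (1 + \<epsilon> l))\<^sup>2"
      using \<delta>_pos[of l] by (simp add: \<epsilon>_def power_mult_distrib power_even_eq)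
    finally show "(c_coeff l \<tau>)\<^sup>2 = (C_BF \<tau> * r_base \<tau> ^ l * (1 + \<epsilon> l))\<^sup>2" .
    show "0 \<le> C_BF \<tau> * r_base \<tau> ^ l * (1 + \<epsilon> l)"
      using C_BF_pos[OF assms] \<delta>_pos[of l] assms by (simp add: \<epsilon>_def r_base_def)
  qed (simp add: c_coeff_def)
  have \<epsilon>_le: "\<bar>\<epsilon> l\<bar> \<le> \<bar>\<delta> l\<bar>" for l
  proof -
    \<comment> \<open>A difference of squares: \<open>\<delta> l\<close> is the square of
      \<open>sqrt (1 + \<delta> l)\<close> minus 1, and the second factor is at least 1.\<close>
    have "\<delta> l = \<epsilon> l * (sqrt (1 + \<delta> l) + 1)"
      using \<delta>_pos[of l] by (simp add: \<epsilon>_def algebra_simps)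
    then have "\<bar>\<delta> l\<bar> = \<bar>\<epsilon> l\<bar> * (sqrt (1 + \<delta> l) + 1)"
      using \<delta>_pos[of l] by (metis abs_mult abs_of_nonneg add_nonneg_nonneg less_imp_le real_sqrt_ge_zero zero_le_one)
    moreover have "\<bar>\<epsilon> l\<bar> * 1 \<le> \<bar>\<epsilon> l\<bar> * (sqrt (1 + \<delta> l) + 1)"
      using \<delta>_pos[of l] by (intro mult_left_mono) auto
    ultimately show ?thesis by simp
  qed
  have "\<epsilon> \<in> O(\<lambda>l. 1 / real l)"
  proof (intro bigoI[of _ K] eventually_sequentiallyI[of 1])
    fix l :: nat assume "1 \<le> l"
    then show "norm (\<epsilon> l) \<le> K * norm (1 / real l)"
      using \<delta>_le[of l] \<epsilon>_le[of l] by simp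
  qed
  with c have part1: "\<exists>\<epsilon> :: nat \<Rightarrow> real. \<epsilon> \<in> O(\<lambda>l. 1 / real l) \<and>
      (\<forall>l. c_coeff l \<tau> = C_BF \<tau> * r_base \<tau> ^ l * (1 + \<epsilon> l))"
    by blast
  have part4: "C_BF \<tau> = cmod (L2_inner \<Omega> (U \<Omega>))" if "metaplectic_operator (S_tau \<tau>) U" for U
  proof (rule power2_eq_imp_eq)
    show "(C_BF \<tau>)\<^sup>2 = (cmod (L2_inner \<Omega> (U \<Omega>)))\<^sup>2"
      unfolding C_BF_square[OF assms] S_tau_gaussian_coefficient[OF assms that] ..
    show "0 \<le> C_BF \<tau>" using C_BF_pos[OF assms] by simp
  qed simp
  have "S_tau \<tau> \<in> Sp2R"
    using metaplectic_operator_S_tau[OF assms] by (simp add: metaplectic_operator_def)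
  with part1 part2 part4 show ?thesis by blast
qed

end
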